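(* Let $n>2$ and $N\ge1$ be integers. The normaliser of $\Gamma_0(N)$ inside $\mathrm{GL}_n^+(\mathbb{Q})$, i.e. $\{g\in\mathrm{GL}_n^+(\mathbb{Q}) : g^{-1}\Gamma_0(N)g=\Gamma_0(N)\}$, is equal to $\mathbb{Q}_{>0}\cdot\Gamma_0(N)$.
   Context: $\mathrm{GL}_n^+(\mathbb{Q})$ denotes the group of invertible rational $n\times n$ matrices with positive determinant. $\Gamma_0(N)\le\mathrm{SL}_n(\mathbb{Z})$ is the subgroup of integral matrices whose last row is congruent modulo $N$ to $(0,\dots,0,\ast)$. *)

theory Defs
  imports
    "Jordan_Normal_Form.Determinant"
    "HOL-Algebra.Zassenhaus"
    "HOL-Number_Theory.Cong"
begin

definition GL_pos :: "nat \<Rightarrow> rat mat monoid" where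
  "GL_pos n =
    \<lparr>carrier = {A \<in> carrier_mat n n. invertible_mat A \<and> det A > 0},
     mult = (*),
     one = 1\<^sub>m n\<rparr>"

definition SL_int :: "nat \<Rightarrow> int mat set" where
  "SL_int n = {A \<in> carrier_mat n n. det A = 1}"

text \<open>Rows and columns are indexed from 0, so the last row has index \<open>n - 1\<close>, and the
  condition leaves its diagonal entry, the one in column \<open>n - 1\<close>, unconstrained.\<close>

definition Gamma0_int :: "nat \<Rightarrow> nat \<Rightarrow> int mat set" where
  "Gamma0_int n N = {A \<in> SL_int n. \<forall>j < n - 1. [A $$ (n - 1, j) = 0] (mod int N)}"

definition Gamma0 :: "nat \<Rightarrow> nat \<Rightarrow> rat mat set" where
  "Gamma0 n N = map_mat rat_of_int ` Gamma0_int n N"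

lemma GL_pos_simps [simp]:
  "mult (GL_pos n) = (*)"
  "one (GL_pos n) = 1\<^sub>m n"
  by (simp_all add: GL_pos_def)

lemma invertible_mat_if_det_nonzero:
  fixes A :: "'a :: field mat"
  assumes A: "A \<in> carrier_mat n n" and "det A \<noteq> 0"
  obtains B where "B \<in> carrier_mat n n" "A * B = 1\<^sub>m n" "B * A = 1\<^sub>m n" "invertible_mat A"
proof -
  from det_non_zero_imp_unit[OF assms, of "()"]
  obtain B where B: "B \<in> carrier_mat n n" "A * B = 1\<^sub>m n" "B * A = 1\<^sub>m n"
    unfolding Units_def ring_mat_def by auto
  then have "invertible_mat A"
    using A unfolding invertible_mat_def inverts_mat_def by auto
  with B show ?thesis by (rule that)
qed

lemma carrier_GL_pos: "carrier (GL_pos n) = {A \<in> carrier_mat n n. det A > 0}"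
  unfolding GL_pos_def by (auto elim: invertible_mat_if_det_nonzero)

lemma group_GL_pos: "group (GL_pos n)"
proof (rule groupI)
  fix A assume "A \<in> carrier (GL_pos n)"
  then have A: "A \<in> carrier_mat n n" and dA: "det A > 0"
    by (auto simp: carrier_GL_pos)
  from dA have "det A \<noteq> 0" by simp
  with A obtain B where B: "B \<in> carrier_mat n n" "B * A = 1\<^sub>m n"
    by (rule invertible_mat_if_det_nonzero)
  have "det B * det A = 1"
    using det_mult[OF B(1) A] B(2) by simp
  then have "det B > 0"
    using dA zero_less_mult_pos2[of "det B" "det A"] by simp
  with B show "\<exists>B\<in>carrier (GL_pos n). B \<otimes>\<^bsub>GL_pos n\<^esub> A = \<one>\<^bsub>GL_pos n\<^esub>"
    by (auto simp: carrier_GL_pos)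
qed (auto simp: carrier_GL_pos det_mult assoc_mult_mat)

lemma Gamma0_subset_GL_pos: "Gamma0 n N \<subseteq> carrier (GL_pos n)"
  by (auto simp: Gamma0_def Gamma0_int_def SL_int_def carrier_GL_pos)

end

theory Submission
  imports Defs
begin

text \<open>Let \<open>g\<close> normalise \<open>\<Gamma>\<^sub>0(N)\<close> and let \<open>h\<close> be its inverse. Conjugating the elementary
  matrices of \<open>\<Gamma>\<^sub>0(N)\<close> by \<open>g\<close> and by \<open>h\<close> shows that the products of an entry of \<open>g\<close> with an
  entry of \<open>h\<close> are integers, except perhaps for two entries in the last columns. Since \<open>n > 2\<close>, a
  2 by 2 minor of a rank one matrix is available to exclude denominators there as well. Dividing
  \<open>g\<close> by the greatest common divisor \<open>c\<close> of its entries then makes both \<open>g / c\<close> and its inverse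
  integral, so \<open>det (g / c) = 1\<close>, and the same minor argument, now with denominators dividing
  \<open>N\<close>, puts the last row of \<open>g / c\<close> into the required form.\<close>

section \<open>Conjugation of a subset of a group\<close>

text \<open>Conjugation by \<open>g\<close> and by \<open>inv g\<close> are mutually inverse maps,
  so each containment gives one half of the equality. This form is symmetric in \<open>g\<close> and
  its inverse, so later arguments can exchange the two.\<close>

lemma (in group) conj_set_eq_iff:
  assumes g: "g \<in> carrier G" and H: "H \<subseteq> carrier G"
  shows "inv g <# H #> g = H \<longleftrightarrow>
    (\<forall>x\<in>H. inv g \<otimes> x \<otimes> g \<in> H \<and> g \<otimes> x \<otimes> inv g \<in> H)"
proof -
  have set: "inv g <# H #> g = (\<lambda>x. inv g \<otimes> x \<otimes> g) ` H"
    unfolding l_coset_def r_coset_def by auto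
  have 1: "g \<otimes> (inv g \<otimes> x \<otimes> g) \<otimes> inv g = x" if "x \<in> H" for x
  proof -
    have "x \<in> carrier G" using H that by auto
    then show ?thesis using g by (simp add: m_assoc) (simp add: m_assoc[symmetric])
  qed
  have 2: "inv g \<otimes> (g \<otimes> x \<otimes> inv g) \<otimes> g = x" if "x \<in> H" for x
  proof -
    have "x \<in> carrier G" using H that by auto
    then show ?thesis using g by (simp add: m_assoc) (simp add: m_assoc[symmetric])
  qed
  show ?thesis
  proof
    assume eq: "inv g <# H #> g = H"
    show "\<forall>x\<in>H. inv g \<otimes> x \<otimes> g \<in> H \<and> g \<otimes> x \<otimes> inv g \<in> H"
    proof (intro ballI conjI)
      fix x assume x: "x \<in> H"
      then show "inv g \<otimes> x \<otimes> g \<in> H" using eq set by blast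
      from x eq set obtain y where "y \<in> H" "x = inv g \<otimes> y \<otimes> g" by blast
      then show "g \<otimes> x \<otimes> inv g \<in> H" using 1 by simp
    qed
  next
    assume "\<forall>x\<in>H. inv g \<otimes> x \<otimes> g \<in> H \<and> g \<otimes> x \<otimes> inv g \<in> H"
    then show "inv g <# H #> g = H"
      unfolding set using 2 by (auto intro!: image_eqI[where x = "g \<otimes> _ \<otimes> inv g"])
  qed
qed

section \<open>Entrywise description of \<open>Gamma0\<close> and its closure under products and
  inverses\<close>

lemma mat_mult_entry:
  assumes "A \<in> carrier_mat n m" "B \<in> carrier_mat m k" "i < n" "j < k"
  shows "(A * B) $$ (i, j) = (\<Sum>l<m. A $$ (i, l) * B $$ (l, j))"
  using assms by (simp add: scalar_prod_def atLeast0LessThan)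

lemma divide_Ints_iff_cong:
  assumes "N \<ge> 1"
  shows "rat_of_int a / rat_of_nat N \<in> \<int> \<longleftrightarrow> [a = 0] (mod int N)"
proof
  assume "rat_of_int a / rat_of_nat N \<in> \<int>"
  then obtain k where "rat_of_int a / rat_of_nat N = of_int k" by (elim Ints_cases)
  then have "rat_of_int a = of_int (k * int N)" using assms by (simp add: field_simps)
  then have "a = k * int N" by (simp only: of_int_eq_iff)
  then show "[a = 0] (mod int N)" by (simp add: cong_0_iff)
next
  assume "[a = 0] (mod int N)"
  then obtain k where "a = int N * k" by (auto simp: cong_0_iff)
  then show "rat_of_int a / rat_of_nat N \<in> \<int>" using assms by simp
qed

text \<open>Writing the congruence as integrality of a quotient by \<open>N\<close> turns every
  condition on an entry into membership in \<int>, where closure under sums and products does the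
  work.\<close>

lemma mem_Gamma0_iff:
  assumes "N \<ge> 1" "n \<ge> 1"
  shows "A \<in> Gamma0 n N \<longleftrightarrow> A \<in> carrier_mat n n \<and> det A = 1 \<and>
    (\<forall>i<n. \<forall>j<n. A $$ (i, j) \<in> \<int>) \<and> (\<forall>j<n - 1. A $$ (n - 1, j) / of_nat N \<in> \<int>)"
    (is "_ \<longleftrightarrow> ?R")
proof
  assume "A \<in> Gamma0 n N"
  then obtain B where B: "B \<in> carrier_mat n n" "det B = 1"
    "\<forall>j < n - 1. [B $$ (n - 1, j) = 0] (mod int N)" and A: "A = map_mat rat_of_int B"
    unfolding Gamma0_def Gamma0_int_def SL_int_def by auto
  have "A $$ (n - 1, j) / of_nat N \<in> \<int>" if "j < n - 1" for j
    using that B A assms divide_Ints_iff_cong[of N "B $$ (n - 1, j)"] by simp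
  then show ?R using A B by simp
next
  assume R: ?R
  define B where "B = map_mat floor A"
  have B: "B \<in> carrier_mat n n" using R by (simp add: B_def)
  have A: "A = map_mat rat_of_int B"
    using R by (intro eq_matI) (auto simp: B_def elim!: Ints_cases)
  have "rat_of_int (det B) = 1" using R A by simp
  then have "det B = 1" by simp
  moreover have "[B $$ (n - 1, j) = 0] (mod int N)" if "j < n - 1" for j
    using that R A B assms divide_Ints_iff_cong[of N "B $$ (n - 1, j)"] by simp
  ultimately show "A \<in> Gamma0 n N"
    using A B unfolding Gamma0_def Gamma0_int_def SL_int_def by auto
qed

lemma Gamma0_mult:
  assumes "N \<ge> 1" "n \<ge> 1" "A \<in> Gamma0 n N" "B \<in> Gamma0 n N"
  shows "A * B \<in> Gamma0 n N"
proof -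
  note iff = mem_Gamma0_iff[OF assms(1,2)]
  have A: "A \<in> carrier_mat n n" "det A = 1" "\<And>i j. i < n \<Longrightarrow> j < n \<Longrightarrow> A $$ (i, j) \<in> \<int>"
    "\<And>j. j < n - 1 \<Longrightarrow> A $$ (n - 1, j) / of_nat N \<in> \<int>" using assms(3) iff by auto
  have B: "B \<in> carrier_mat n n" "det B = 1" "\<And>i j. i < n \<Longrightarrow> j < n \<Longrightarrow> B $$ (i, j) \<in> \<int>"
    "\<And>j. j < n - 1 \<Longrightarrow> B $$ (n - 1, j) / of_nat N \<in> \<int>" using assms(4) iff by auto
  have "(A * B) $$ (n - 1, j) / of_nat N \<in> \<int>" if j: "j < n - 1" for j
  proof -
    \<comment> \<open>For \<open>l < n - 1\<close> the factor from \<open>A\<close> absorbs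
      \<open>N\<close>; for \<open>l = n - 1\<close> the factor from the last row of
      \<open>B\<close> does.\<close>
    have "A $$ (n - 1, l) * B $$ (l, j) / of_nat N \<in> \<int>" if l: "l < n" for l
    proof (cases "l = n - 1")
      case True
      then show ?thesis
        using Ints_mult[OF A(3)[of "n - 1" "n - 1"] B(4)[OF j]] assms(2) by simp
    next
      case False
      then show ?thesis
        using Ints_mult[OF A(4)[of l] B(3)[of l j]] l j by simp
    qed
    then show ?thesis
      using mat_mult_entry[OF A(1) B(1), of "n - 1" j] j
      by (auto simp: sum_divide_distrib intro!: Ints_sum)
  qed
  moreover have "(A * B) $$ (i, j) \<in> \<int>" if "i < n" "j < n" for i j
    using mat_mult_entry[OF A(1) B(1) that] that A(3) B(3) by (auto intro!: Ints_sum)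
  ultimately show ?thesis
    using A(1,2) B(1,2) by (simp add: iff det_mult)
qed

lemma Gamma0_inverse:
  assumes N: "N \<ge> 1" and n: "n \<ge> 1" and A: "A \<in> Gamma0 n N"
  obtains B where "B \<in> Gamma0 n N" "A * B = 1\<^sub>m n" "B * A = 1\<^sub>m n"
proof -
  note iff = mem_Gamma0_iff[OF N n]
  obtain C where C: "C \<in> carrier_mat n n" "det C = 1" and AC: "A = map_mat rat_of_int C"
    using A unfolding Gamma0_def Gamma0_int_def SL_int_def by auto
  define B where "B = map_mat rat_of_int (adj_mat C)"
  have adj: "adj_mat C \<in> carrier_mat n n" "C * adj_mat C = 1\<^sub>m n" "adj_mat C * C = 1\<^sub>m n"
    using adj_mat[OF C(1)] C by auto
  have A': "A \<in> carrier_mat n n" "det A = 1" "\<And>i j. i < n \<Longrightarrow> j < n \<Longrightarrow> A $$ (i, j) \<in> \<int>"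
    "\<And>j. j < n - 1 \<Longrightarrow> A $$ (n - 1, j) / of_nat N \<in> \<int>" using A iff by auto
  have B: "B \<in> carrier_mat n n" "\<And>i j. i < n \<Longrightarrow> j < n \<Longrightarrow> B $$ (i, j) \<in> \<int>"
    using adj by (auto simp: B_def)
  have AB: "A * B = 1\<^sub>m n" "B * A = 1\<^sub>m n"
    unfolding AC B_def using adj C
    by (metis of_int_hom.mat_hom_mult of_int_hom.mat_hom_one)+
  have "det B = 1" using det_mult[OF A'(1) B(1)] AB A' by simp
  moreover have "B $$ (n - 1, j) / of_nat N \<in> \<int>" if j: "j < n - 1" for j
  proof -
    let ?X = "B $$ (n - 1, j) / of_nat N"
    have split: "{..<n} = insert (n - 1) {..<n - 1}" using n by auto
    have off: "A $$ (n - 1, l) * b / of_nat N \<in> \<int>" if "l < n - 1" "b \<in> \<int>" for l b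
      using Ints_mult[OF A'(4)[OF that(1)] that(2)] by simp
    \<comment> \<open>In entry \<open>(n - 1, j)\<close> of \<open>A * B = 1\<close> all terms but
      the last are divisible by \<open>N\<close>, hence so is the last one.\<close>
    have "0 = (A * B) $$ (n - 1, j) / of_nat N" using AB j by simp
    also have "\<dots> = A $$ (n - 1, n - 1) * ?X
        + (\<Sum>l<n - 1. A $$ (n - 1, l) * B $$ (l, j) / of_nat N)"
      using mat_mult_entry[OF A'(1) B(1), of "n - 1" j] j
      by (simp add: split sum_divide_distrib add_divide_distrib)
    finally have "A $$ (n - 1, n - 1) * ?X
        = - (\<Sum>l<n - 1. A $$ (n - 1, l) * B $$ (l, j) / of_nat N)" by simp
    also have "\<dots> \<in> \<int>" using off B(2) j by (auto intro!: Ints_sum Ints_minus)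
    finally have diag: "A $$ (n - 1, n - 1) * ?X \<in> \<int>" .
    \<comment> \<open>The diagonal entry of \<open>A * B = 1\<close> shows that the corner entries
      of \<open>A\<close> and \<open>B\<close> are inverse to each other modulo \<open>N\<close>, so
      the corner of \<open>A\<close> can be cancelled from \<open>diag\<close>.\<close>
    have "?X = (A * B) $$ (n - 1, n - 1) * ?X" using AB n by simp
    also have "\<dots> = (A $$ (n - 1, n - 1) * ?X) * B $$ (n - 1, n - 1)
        + (\<Sum>l<n - 1. A $$ (n - 1, l) * (B $$ (l, n - 1) * B $$ (n - 1, j)) / of_nat N)"
      using mat_mult_entry[OF A'(1) B(1), of "n - 1" "n - 1"] n
      by (simp add: split sum_distrib_right sum_divide_distrib add_divide_distrib
        distrib_right mult.assoc)
    also have "\<dots> \<in> \<int>" using off B(2) j n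
      by (intro Ints_add Ints_mult[OF diag] Ints_sum off) auto
    finally show ?thesis .
  qed
  ultimately have "B \<in> Gamma0 n N" using B by (simp add: iff)
  then show ?thesis using AB that by blast
qed

section \<open>Conjugates of elementary matrices, and a rank one argument\<close>

text \<open>\<open>addrow_mat n 1 i j\<close> is the identity plus the matrix unit at
  \<open>(i, j)\<close>, so its conjugate is the identity plus column \<open>i\<close> of
  \<open>g\<close> times row \<open>j\<close> of \<open>h\<close>.\<close>

lemma conj_addrow_mat_entry:
  fixes g h :: "'a :: comm_ring_1 mat"
  assumes g: "g \<in> carrier_mat n n" and h: "h \<in> carrier_mat n n" and gh: "g * h = 1\<^sub>m n"
    and "i < n" "j < n" "a < n" "b < n"
  shows "(g * addrow_mat n 1 i j * h) $$ (a, b) = g $$ (a, i) * h $$ (j, b) + (if a = b then 1 else 0)"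
proof -
  have "(g * addrow_mat n 1 i j * h) $$ (a, b)
      = (\<Sum>l<n. (addcol 1 j i g) $$ (a, l) * h $$ (l, b))"
    using assms by (subst addcol_mat[OF g \<open>i < n\<close>, symmetric], subst mat_mult_entry[OF _ h])
      auto
  also have "\<dots> = (\<Sum>l<n. (if j = l then g $$ (a, i) * h $$ (l, b) else 0) + g $$ (a, l) * h $$ (l, b))"
    using assms by (intro sum.cong) (auto simp: algebra_simps)
  also have "\<dots> = g $$ (a, i) * h $$ (j, b) + (g * h) $$ (a, b)"
    using assms mat_mult_entry[OF g h, of a b] by (simp add: sum.distrib)
  finally show ?thesis using gh assms by simp
qed

text \<open>With \<open>i < n - 1\<close> the last row stays that of the identity. This is why
  column \<open>n - 1\<close> needs separate treatment below, whereas \<open>j = n - 1\<close> is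
  allowed.\<close>

lemma addrow_mat_in_Gamma0:
  assumes "N \<ge> 1" "i < n - 1" "j < n" "i \<noteq> j"
  shows "addrow_mat n 1 i j \<in> Gamma0 n N"
proof -
  have "n \<ge> 1" using assms by simp
  with assms show ?thesis by (auto simp: mem_Gamma0_iff det_addrow_mat)
qed

lemma conj_elementary_Ints:
  assumes N: "N \<ge> 1" and g: "g \<in> carrier_mat n n" and h: "h \<in> carrier_mat n n"
    and gh: "g * h = 1\<^sub>m n"
    and norm: "\<And>x. x \<in> Gamma0 n N \<Longrightarrow> g * x * h \<in> Gamma0 n N"
    and ij: "i < n - 1" "j < n" "i \<noteq> j"
  shows "\<And>a b. a < n \<Longrightarrow> b < n \<Longrightarrow> g $$ (a, i) * h $$ (j, b) \<in> \<int>"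
    and "\<And>b. b < n - 1 \<Longrightarrow> g $$ (n - 1, i) * h $$ (j, b) / of_nat N \<in> \<int>"
proof -
  have n: "n \<ge> 1" "i < n" using ij by auto
  have "g * addrow_mat n 1 i j * h \<in> Gamma0 n N"
    using norm addrow_mat_in_Gamma0[OF N ij] by blast
  note mem = this[unfolded mem_Gamma0_iff[OF N n(1)]]
  note entry = conj_addrow_mat_entry[OF g h gh n(2) ij(2)]
  show "g $$ (a, i) * h $$ (j, b) \<in> \<int>" if ab: "a < n" "b < n" for a b
  proof -
    have "g $$ (a, i) * h $$ (j, b) + (if a = b then 1 else 0) \<in> \<int>"
      using mem entry[OF ab] ab by metis
    from Ints_diff[OF this, of "if a = b then 1 else 0"] show ?thesis by simp
  qed
  show "g $$ (n - 1, i) * h $$ (j, b) / of_nat N \<in> \<int>" if b: "b < n - 1" for b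
    \<comment> \<open>As \<open>b\<close> differs from \<open>n - 1\<close>, the identity
      contributes nothing to this entry.\<close>
    using mem entry[of "n - 1" b] b by auto
qed

text \<open>The matrix with entries \<open>P b b' = g $$ (b, i) * h $$ (i, b')\<close> has rank one, so
  \<open>P 0 0 * P 1 1 = P 0 1 * P 1 0\<close>. As \<open>g * h = 1\<close>, it agrees with the identity modulo the
  denominator of \<open>X\<close>, which must therefore be 1.\<close>

lemma Ints_of_rank_one:
  fixes g h :: "'a :: comm_ring_1 mat"
  assumes g: "g \<in> carrier_mat n n" and h: "h \<in> carrier_mat n n" and gh: "g * h = 1\<^sub>m n"
    and n: "n \<ge> 2" "i < n"
    and off: "\<And>b b' j. b < 2 \<Longrightarrow> b' < 2 \<Longrightarrow> j < n \<Longrightarrow> j \<noteq> i \<Longrightarrow> X * (g $$ (b, j) * h $$ (j, b')) \<in> \<int>"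
    and int: "\<And>b b'. b < 2 \<Longrightarrow> b' < 2 \<Longrightarrow> g $$ (b, i) * h $$ (i, b') \<in> \<int>"
  shows "X \<in> \<int>"
proof -
  define P where "P b b' = g $$ (b, i) * h $$ (i, b')" for b b'
  have delta: "X * ((if b = b' then 1 else 0) - P b b') \<in> \<int>" if b: "b < 2" "b' < 2" for b b'
  proof -
    have "(if b = b' then 1 else 0) = (g * h) $$ (b, b')" using gh b n by simp
    also have "\<dots> = (\<Sum>j<n. g $$ (b, j) * h $$ (j, b'))"
      using mat_mult_entry[OF g h] b n by simp
    also have "\<dots> = P b b' + (\<Sum>j\<in>{..<n} - {i}. g $$ (b, j) * h $$ (j, b'))"
      unfolding P_def using n by (intro sum.remove) auto
    finally have "X * ((if b = b' then 1 else 0) - P b b')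
        = (\<Sum>j\<in>{..<n} - {i}. X * (g $$ (b, j) * h $$ (j, b')))"
      by (simp add: sum_distrib_left)
    also have "\<dots> \<in> \<int>" using off b by (intro Ints_sum) auto
    finally show ?thesis .
  qed
  have P: "P b b' \<in> \<int>" if "b < 2" "b' < 2" for b b' using int that by (simp add: P_def)
  \<comment> \<open>The right side expands to
    \<open>X - X * (P 0 0 * P 1 1 - P 0 1 * P 1 0)\<close>, and the minor vanishes.\<close>
  have "X = X * (1 - P 0 0) + P 0 0 * (X * (1 - P 1 1)) - P 1 0 * (X * (0 - P 0 1))"
    by (simp add: P_def algebra_simps)
  also have "\<dots> \<in> \<int>"
    using delta[of 0 0] delta[of 1 1] delta[of 0 1] P[of 0 0] P[of 1 0]
    by (intro Ints_add Ints_diff Ints_mult[of "P _ _"]) auto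
  finally show ?thesis .
qed

section \<open>Integrality of the products of entries of \<open>g\<close> and
  \<open>h\<close>\<close>

lemma normaliser_column_products:
  assumes N: "N \<ge> 1" and n: "n > 2" and g: "g \<in> carrier_mat n n" and h: "h \<in> carrier_mat n n"
    and gh: "g * h = 1\<^sub>m n" and hg: "h * g = 1\<^sub>m n"
    and norm: "\<And>x. x \<in> Gamma0 n N \<Longrightarrow> g * x * h \<in> Gamma0 n N"
    and i: "i < n - 1" and j: "j < n" and ab: "a < n" "b < n"
  shows "g $$ (a, i) * h $$ (j, b) \<in> \<int>"
proof (cases "i = j")
  case False
  then show ?thesis using conj_elementary_Ints(1)[OF N g h gh norm i j] ab by blast
next
  case True
  \<comment> \<open>No elementary matrix handles \<open>i = j\<close> directly. Since
    \<open>n > 2\<close> there is a second index \<open>k < n - 1\<close>; inserting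
    \<open>(h * g) $$ (k, k) = 1\<close> splits the product into terms with the unequal index pairs
    \<open>(i, k)\<close> and \<open>(k, i)\<close>.\<close>
  define k :: nat where "k = (if i = 0 then 1 else 0)"
  have k: "k < n - 1" "k \<noteq> i" using n i by (auto simp: k_def)
  have "g $$ (a, i) * h $$ (i, b) = g $$ (a, i) * (h * g) $$ (k, k) * h $$ (i, b)"
    using hg k by simp
  also have "\<dots> = (\<Sum>c<n. (g $$ (a, i) * h $$ (k, c)) * (g $$ (c, k) * h $$ (i, b)))"
    using mat_mult_entry[OF h g, of k k] k
    by (simp add: sum_distrib_left sum_distrib_right mult.assoc)
  also have "\<dots> \<in> \<int>"
  proof (intro Ints_sum Ints_mult[of "g $$ (a, i) * _"])
    fix c assume "c \<in> {..<n}"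
    then show "g $$ (a, i) * h $$ (k, c) \<in> \<int>" "g $$ (c, k) * h $$ (i, b) \<in> \<int>"
      using conj_elementary_Ints(1)[OF N g h gh norm, of i k]
        conj_elementary_Ints(1)[OF N g h gh norm, of k i] i k ab by auto
  qed
  finally show ?thesis using True by simp
qed

lemma normaliser_products:
  assumes N: "N \<ge> 1" and n: "n > 2" and g: "g \<in> carrier_mat n n" and h: "h \<in> carrier_mat n n"
    and gh: "g * h = 1\<^sub>m n" and hg: "h * g = 1\<^sub>m n"
    and norm: "\<And>x. x \<in> Gamma0 n N \<Longrightarrow> g * x * h \<in> Gamma0 n N"
      "\<And>x. x \<in> Gamma0 n N \<Longrightarrow> h * x * g \<in> Gamma0 n N"
    and abcd: "a < n" "b < n" "c < n" "d < n"
  shows "g $$ (a, b) * h $$ (c, d) \<in> \<int>"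
proof -
  \<comment> \<open>The case \<open>d < n - 1\<close> is the case \<open>b < n - 1\<close> with
    \<open>g\<close> and \<open>h\<close> exchanged.\<close>
  have prod: "g $$ (a, b) * h $$ (c, d) \<in> \<int>"
    if "a < n" "b < n" "c < n" "d < n" "b < n - 1 \<or> d < n - 1" for a b c d
    using that normaliser_column_products[OF N n g h gh hg norm(1), of b c a d]
      normaliser_column_products[OF N n h g hg gh norm(2), of d a c b]
    by (auto simp: mult.commute)
  show ?thesis
  proof (cases "b = n - 1 \<and> d = n - 1")
    case False
    then have "b < n - 1 \<or> d < n - 1" using abcd by linarith
    then show ?thesis using prod abcd by blast
  next
    case True
    show ?thesis
    proof (rule Ints_of_rank_one[OF g h gh, where i = "n - 1"])
      fix e e' j :: nat assume e: "e < 2" "e' < 2" and j: "j < n" "j \<noteq> n - 1"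
      \<comment> \<open>After regrouping, each product has a factor outside the last column:
        \<open>e' < 2\<close> lies below \<open>n - 1\<close> because \<open>n > 2\<close>, and
        \<open>j\<close> is not \<open>n - 1\<close>.\<close>
      have "(g $$ (a, b) * h $$ (j, e')) * (g $$ (e, j) * h $$ (c, d)) \<in> \<int>"
        using e j n abcd by (intro Ints_mult prod) auto
      then show "g $$ (a, b) * h $$ (c, d) * (g $$ (e, j) * h $$ (j, e')) \<in> \<int>"
        by (simp add: ac_simps)
    next
      fix e e' :: nat assume e: "e < 2" "e' < 2"
      then show "g $$ (e, n - 1) * h $$ (n - 1, e') \<in> \<int>" using n by (intro prod) auto
    qed (use n in auto)
  qed
qed

section \<open>The content of a finite set of rationals\<close>

text \<open>The number \<open>c\<close> is the greatest common divisor of \<open>S\<close>, that is,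
  the positive generator of the fractional ideal spanned by \<open>S\<close>. Hence
  \<open>c * t\<close> is an integer combination of the integers \<open>s * t\<close>.\<close>

lemma common_content:
  fixes S T :: "rat set"
  assumes fin: "finite S" and nz: "\<exists>s\<in>S. s \<noteq> 0"
    and prod: "\<And>s t. s \<in> S \<Longrightarrow> t \<in> T \<Longrightarrow> s * t \<in> \<int>"
  obtains c where "c > 0" "\<And>s. s \<in> S \<Longrightarrow> s / c \<in> \<int>" "\<And>t. t \<in> T \<Longrightarrow> c * t \<in> \<int>"
proof -
  have "\<exists>d::int. d > 0 \<and> (\<forall>s\<in>S. of_int d * s \<in> \<int>)"
    using fin
  proof (induction S)
    case empty
    show ?case by (auto intro: exI[of _ 1])
  next
    case (insert s S)
    then obtain d :: int where d: "d > 0" "\<forall>s\<in>S. of_int d * s \<in> \<int>" by blast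
    obtain p q where s: "s = of_int p / of_int q" and q: "q > 0"
      by (cases s) (auto simp: Fract_of_int_quotient)
    have "of_int (d * q) * s = of_int (d * p)" using s q by simp
    then have "of_int (d * q) * s \<in> \<int>" by (metis Ints_of_int)
    moreover have "of_int (d * q) * t \<in> \<int>" if "t \<in> S" for t
      using Ints_mult[OF Ints_of_int[of q], of "of_int d * t"] d that by (simp add: ac_simps)
    ultimately show ?case using d q by (intro exI[of _ "d * q"]) auto
  qed
  then obtain d :: int where d: "d > 0" "\<And>s. s \<in> S \<Longrightarrow> of_int d * s \<in> \<int>" by blast
  \<comment> \<open>The floor only changes the type, since \<open>d\<close> is a common denominator
    of \<open>S\<close>. The content will be \<open>r / d\<close> with
    \<open>r = Gcd G\<close>.\<close>
  define G where "G = (\<lambda>s. \<lfloor>of_int d * s\<rfloor>) ` S"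
  have fl: "of_int \<lfloor>of_int d * s\<rfloor> = of_int d * s" if "s \<in> S" for s
    using d(2)[OF that] by (auto elim!: Ints_cases)
  define r where "r = Gcd G"
  from nz obtain s0 where s0: "s0 \<in> S" "s0 \<noteq> 0" by blast
  then have "\<lfloor>of_int d * s0\<rfloor> \<noteq> 0" using fl[of s0] d by fastforce
  then have "r \<noteq> 0" using s0 by (auto simp: r_def G_def)
  then have r: "r > 0" unfolding r_def by (metis Gcd_int_greater_eq_0 order_le_less)
  show ?thesis
  proof
    show "of_int r / of_int d > (0::rat)" using r d by simp
    fix s assume s: "s \<in> S"
    then have "r dvd \<lfloor>of_int d * s\<rfloor>" unfolding r_def G_def by (intro Gcd_dvd) auto
    then obtain k where "\<lfloor>of_int d * s\<rfloor> = r * k" by (elim dvdE)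
    then have "of_int d * s = of_int r * of_int k" using fl[OF s] by (metis of_int_mult)
    then have "s / (of_int r / of_int d) = of_int k" using r d by (simp add: field_simps)
    then show "s / (of_int r / of_int d) \<in> \<int>" by simp
  next
    fix t assume t: "t \<in> T"
    obtain p q where tpq: "t = of_int p / of_int q" and q: "q > 0"
      by (cases t) (auto simp: Fract_of_int_quotient)
    \<comment> \<open>This says that \<open>s * t = (x / d) * (p / q)\<close> is an integer; unlike
      that form, it passes to the gcd over all \<open>x\<close>, which is \<open>p * r\<close> up to
      sign.\<close>
    have "d * q dvd p * x" if "x \<in> G" for x
    proof -
      from that obtain s where s: "s \<in> S" and x: "x = \<lfloor>of_int d * s\<rfloor>" by (auto simp: G_def)
      obtain k where k: "s * t = of_int k" using prod[OF s t] by (elim Ints_cases)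
      have "of_int (p * x) = of_int p * (of_int d * s)" using fl[OF s] by (simp add: x)
      also have "\<dots> = of_int d * of_int q * (s * t)" using q by (simp add: tpq)
      also have "\<dots> = of_int (d * q * k)" by (simp add: k)
      finally have "of_int (p * x) = (of_int (d * q * k) :: rat)" .
      then have "p * x = d * q * k" by (simp only: of_int_eq_iff)
      then show ?thesis by simp
    qed
    then have "d * q dvd Gcd ((*) p ` G)" by (intro Gcd_greatest) auto
    then have "d * q dvd p * r" by (simp add: Gcd_mult r_def)
    then obtain k where "p * r = d * q * k" by (elim dvdE)
    then have "of_int p * of_int r = (of_int d * of_int q * of_int k :: rat)"
      by (metis of_int_mult)
    then have "of_int r / of_int d * t = of_int k" using q d by (simp add: tpq field_simps)
    then show "of_int r / of_int d * t \<in> \<int>" by simp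
  qed
qed

section \<open>Scalar multiples, inverses and integral determinants\<close>

lemma smult_smult_mat: "a \<cdot>\<^sub>m (b \<cdot>\<^sub>m A) = (a * b) \<cdot>\<^sub>m (A :: 'a :: semigroup_mult mat)"
  by (rule eq_matI) (auto simp: mult.assoc)

lemma one_smult_mat [simp]: "1 \<cdot>\<^sub>m A = (A :: 'a :: monoid_mult mat)"
  by (rule eq_matI) auto

lemma smult_conj:
  fixes g h x :: "'a :: field mat"
  assumes "g \<in> carrier_mat n n" "h \<in> carrier_mat n n" "x \<in> carrier_mat n n" "c \<noteq> 0"
  shows "(c \<cdot>\<^sub>m g) * x * (inverse c \<cdot>\<^sub>m h) = g * x * h"
    and "(inverse c \<cdot>\<^sub>m h) * x * (c \<cdot>\<^sub>m g) = h * x * g"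
  using assms
  by (simp_all add: mult_smult_assoc_mat[of _ n n _ n] mult_smult_distrib[of _ n n _ n] smult_smult_mat)

lemma GL_pos_inv_eq:
  assumes "g \<in> carrier (GL_pos n)" "h \<in> carrier_mat n n" "g * h = 1\<^sub>m n" "h * g = 1\<^sub>m n"
  shows "inv\<^bsub>GL_pos n\<^esub> g = h"
proof -
  interpret group "GL_pos n" by (rule group_GL_pos)
  have g: "g \<in> carrier_mat n n" "det g > 0" using assms by (auto simp: carrier_GL_pos)
  have "det g * det h = 1" using det_mult[OF g(1) assms(2)] assms(3) by simp
  then have "det h > 0" using g zero_less_mult_pos[of "det g" "det h"] by simp
  then have "h \<in> carrier (GL_pos n)" using assms by (simp add: carrier_GL_pos)
  then show ?thesis using assms inv_equality by simp
qed

lemma det_Ints: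
  fixes A :: "'a :: comm_ring_1 mat"
  assumes "A \<in> carrier_mat n n" "\<And>i j. i < n \<Longrightarrow> j < n \<Longrightarrow> A $$ (i, j) \<in> \<int>"
  shows "det A \<in> \<int>"
  unfolding det_def'[OF assms(1)]
  by (intro Ints_sum Ints_mult Ints_prod assms(2)) (auto simp: permutes_in_image sign_def)

section \<open>Determination of the normaliser\<close>

lemma smult_Gamma0_if_normaliser:
  assumes N: "N \<ge> 1" and n: "n > 2" and g: "g \<in> carrier_mat n n" and h: "h \<in> carrier_mat n n"
    and gh: "g * h = 1\<^sub>m n" and hg: "h * g = 1\<^sub>m n" and det: "det g > 0"
    and norm: "\<And>x. x \<in> Gamma0 n N \<Longrightarrow> g * x * h \<in> Gamma0 n N"
      "\<And>x. x \<in> Gamma0 n N \<Longrightarrow> h * x * g \<in> Gamma0 n N"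
  shows "\<exists>c \<gamma>. g = c \<cdot>\<^sub>m \<gamma> \<and> c > 0 \<and> \<gamma> \<in> Gamma0 n N"
proof -
  define S where "S = (\<lambda>(i, j). g $$ (i, j)) ` ({..<n} \<times> {..<n})"
  define T where "T = (\<lambda>(i, j). h $$ (i, j)) ` ({..<n} \<times> {..<n})"
  have nz: "\<exists>s\<in>S. s \<noteq> 0"
  proof (rule ccontr)
    assume "\<not> ?thesis"
    then have "g $$ (0, j) = 0" if "j < n" for j using that n by (auto simp: S_def)
    then have "(g * h) $$ (0, 0) = 0" using mat_mult_entry[OF g h, of 0 0] n by simp
    then show False using gh n by simp
  qed
  have fin: "finite S" by (simp add: S_def)
  have prod: "s * t \<in> \<int>" if "s \<in> S" "t \<in> T" for s t
    using that normaliser_products[OF N n g h gh hg norm] by (auto simp: S_def T_def)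
  obtain c where c: "c > 0" "\<And>s. s \<in> S \<Longrightarrow> s / c \<in> \<int>" "\<And>t. t \<in> T \<Longrightarrow> c * t \<in> \<int>"
    using common_content[OF fin nz prod] by blast
  define \<gamma> \<eta> where "\<gamma> = inverse c \<cdot>\<^sub>m g" and "\<eta> = c \<cdot>\<^sub>m h"
  have carr: "\<gamma> \<in> carrier_mat n n" "\<eta> \<in> carrier_mat n n" using g h by (auto simp: \<gamma>_def \<eta>_def)
  have int: "\<gamma> $$ (i, j) \<in> \<int>" "\<eta> $$ (i, j) \<in> \<int>" if "i < n" "j < n" for i j
  proof -
    have "g $$ (i, j) \<in> S" "h $$ (i, j) \<in> T" using that by (auto simp: S_def T_def)
    from c(2)[OF this(1)] c(3)[OF this(2)] show "\<gamma> $$ (i, j) \<in> \<int>" "\<eta> $$ (i, j) \<in> \<int>"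
      using that g h by (simp_all add: \<gamma>_def \<eta>_def divide_inverse mult.commute)
  qed
  have \<gamma>\<eta>: "\<gamma> * \<eta> = 1\<^sub>m n"
    using g h gh c(1)
    by (simp add: \<gamma>_def \<eta>_def mult_smult_assoc_mat[of _ n n _ n] mult_smult_distrib[of _ n n _ n]
      smult_smult_mat)
  have norm': "\<gamma> * x * \<eta> \<in> Gamma0 n N" if "x \<in> Gamma0 n N" for x
  proof -
    have "x \<in> carrier_mat n n" using that Gamma0_subset_GL_pos by (auto simp: carrier_GL_pos)
    \<comment> \<open>The roles of \<open>g\<close> and \<open>h\<close> are exchanged here because
      \<open>inverse c\<close> now multiplies \<open>g\<close>.\<close>
    then show ?thesis using smult_conj(2)[OF h g, of x c] norm(1)[OF that] c(1)
      by (simp add: \<gamma>_def \<eta>_def)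
  qed
  have "det \<gamma> > 0" using det c(1) by (simp add: \<gamma>_def)
  moreover have "det \<gamma> * det \<eta> = 1" using det_mult[OF carr] \<gamma>\<eta> by simp
  ultimately have "det \<gamma> = 1"
  proof -
    \<comment> \<open>Both determinants are integers with product 1, and positivity excludes
      -1.\<close>
    obtain p q where pq: "det \<gamma> = of_int p" "det \<eta> = of_int q"
      using det_Ints[OF carr(1) int(1)] det_Ints[OF carr(2) int(2)] by (auto elim!: Ints_cases)
    then have "of_int (p * q) = (1 :: rat)" "p > 0"
      using \<open>det \<gamma> * det \<eta> = 1\<close> \<open>det \<gamma> > 0\<close> by auto
    then have "p * q = 1" by (simp only: of_int_eq_1_iff)
    then show ?thesis using \<open>p > 0\<close> pq by (auto simp: zmult_eq_1_iff)
  qed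
  moreover have "\<gamma> $$ (n - 1, i) / of_nat N \<in> \<int>" if i: "i < n - 1" for i
  proof (rule Ints_of_rank_one[OF carr \<gamma>\<eta>, where i = i])
    fix b b' j :: nat assume b: "b < 2" "b' < 2" and j: "j < n" "j \<noteq> i"
    \<comment> \<open>The second factor comes from the last row of a conjugate in
      \<open>Gamma0 n N\<close>, at column \<open>b' < 2\<close>, which is not the last one as
      \<open>n > 2\<close>.\<close>
    have "\<gamma> $$ (b, j) * (\<gamma> $$ (n - 1, i) * \<eta> $$ (j, b') / of_nat N) \<in> \<int>"
      using conj_elementary_Ints(2)[OF N carr \<gamma>\<eta> norm' i j(1) j(2)[symmetric], of b'] int(1)[of b j] b j n
      by (intro Ints_mult) auto
    then show "\<gamma> $$ (n - 1, i) / of_nat N * (\<gamma> $$ (b, j) * \<eta> $$ (j, b')) \<in> \<int>"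
      by (simp add: ac_simps)
  qed (use n i int in \<open>auto intro!: Ints_mult\<close>)
  ultimately have "\<gamma> \<in> Gamma0 n N" using N n int carr by (simp add: mem_Gamma0_iff)
  moreover have "g = c \<cdot>\<^sub>m \<gamma>" using c(1) by (simp add: \<gamma>_def smult_smult_mat)
  ultimately show ?thesis using c(1) by blast
qed

theorem theorem4p1:
  fixes n N :: nat
  assumes "n > 2" and "N \<ge> 1"
  shows "{g \<in> carrier (GL_pos n).
            inv\<^bsub>GL_pos n\<^esub> g <#\<^bsub>GL_pos n\<^esub> Gamma0 n N #>\<^bsub>GL_pos n\<^esub> g = Gamma0 n N}
         = {c \<cdot>\<^sub>m \<gamma> | c \<gamma>. c > 0 \<and> \<gamma> \<in> Gamma0 n N}"
proof -
  interpret group "GL_pos n" by (rule group_GL_pos)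
  have normal: "inv\<^bsub>GL_pos n\<^esub> g <#\<^bsub>GL_pos n\<^esub> Gamma0 n N #>\<^bsub>GL_pos n\<^esub> g = Gamma0 n N \<longleftrightarrow>
      (\<forall>x\<in>Gamma0 n N. h * x * g \<in> Gamma0 n N \<and> g * x * h \<in> Gamma0 n N)"
    if "g \<in> carrier (GL_pos n)" "h \<in> carrier_mat n n" "g * h = 1\<^sub>m n" "h * g = 1\<^sub>m n" for g h
    using conj_set_eq_iff[OF that(1) Gamma0_subset_GL_pos, of N] GL_pos_inv_eq[OF that] by simp
  show ?thesis
  proof (intro equalityI subsetI)
    fix g
    assume "g \<in> {g \<in> carrier (GL_pos n).
      inv\<^bsub>GL_pos n\<^esub> g <#\<^bsub>GL_pos n\<^esub> Gamma0 n N #>\<^bsub>GL_pos n\<^esub> g = Gamma0 n N}"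
    then have g: "g \<in> carrier (GL_pos n)"
      and eq: "inv\<^bsub>GL_pos n\<^esub> g <#\<^bsub>GL_pos n\<^esub> Gamma0 n N #>\<^bsub>GL_pos n\<^esub> g = Gamma0 n N" by auto
    from g have g': "g \<in> carrier_mat n n" "det g > 0" by (auto simp: carrier_GL_pos)
    then have "det g \<noteq> 0" by simp
    with g'(1) obtain h where h: "h \<in> carrier_mat n n" "g * h = 1\<^sub>m n" "h * g = 1\<^sub>m n"
      by (rule invertible_mat_if_det_nonzero)
    show "g \<in> {c \<cdot>\<^sub>m \<gamma> | c \<gamma>. c > 0 \<and> \<gamma> \<in> Gamma0 n N}"
      using smult_Gamma0_if_normaliser[OF assms(2,1) g'(1) h g'(2)] normal[OF g h] eq by auto
  next
    fix g assume "g \<in> {c \<cdot>\<^sub>m \<gamma> | c \<gamma>. c > 0 \<and> \<gamma> \<in> Gamma0 n N}"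
    then obtain c \<gamma> where c: "c > 0" and \<gamma>: "\<gamma> \<in> Gamma0 n N" and g: "g = c \<cdot>\<^sub>m \<gamma>" by blast
    have n: "n \<ge> 1" using assms by simp
    obtain \<eta> where \<eta>: "\<eta> \<in> Gamma0 n N" "\<gamma> * \<eta> = 1\<^sub>m n" "\<eta> * \<gamma> = 1\<^sub>m n"
      using Gamma0_inverse[OF assms(2) n \<gamma>] .
    have carr: "x \<in> carrier_mat n n" if "x \<in> Gamma0 n N" for x
      using that Gamma0_subset_GL_pos by (auto simp: carrier_GL_pos)
    define h where "h = inverse c \<cdot>\<^sub>m \<eta>"
    have gG: "g \<in> carrier (GL_pos n)"
      using \<gamma> c carr[OF \<gamma>] Gamma0_subset_GL_pos[of n N] by (auto simp: g carrier_GL_pos)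
    have h: "h \<in> carrier_mat n n" "g * h = 1\<^sub>m n" "h * g = 1\<^sub>m n"
      using carr[OF \<gamma>] carr[OF \<eta>(1)] \<eta>(2,3) c
      by (auto simp: g h_def mult_smult_assoc_mat[of _ n n _ n] mult_smult_distrib[of _ n n _ n]
        smult_smult_mat)
    \<comment> \<open>The scalars cancel, leaving conjugation by an element of
      \<open>Gamma0 n N\<close>.\<close>
    have "h * x * g \<in> Gamma0 n N \<and> g * x * h \<in> Gamma0 n N" if x: "x \<in> Gamma0 n N" for x
      using smult_conj[OF carr[OF \<gamma>] carr[OF \<eta>(1)] carr[OF x], of c] c \<gamma> \<eta>(1) x
        Gamma0_mult[OF assms(2) n] by (simp add: g h_def)
    then show "g \<in> {g \<in> carrier (GL_pos n).
        inv\<^bsub>GL_pos n\<^esub> g <#\<^bsub>GL_pos n\<^esub> Gamma0 n N #>\<^bsub>GL_pos n\<^esub> g = Gamma0 n N}"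
      using normal[OF gG h] gG by simp
  qed
qed

end
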